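(* For any couple of real numbers $(\delta_0,\delta)$ such that $0<\delta_0<\delta<1$, there exists $n_0\in\mathbb{N}$ such that for any $q\in\mathbb{C}$ with $\delta_0\leq |q|\leq \delta$ and for any integer $n\geq n_0$, the entire function $z\mapsto\theta(q,z)$ has exactly $n$ zeros, counted with multiplicity, in the open disk $\{z\in\mathbb{C} : |z|<|q|^{-n-1/2}\}$.
   Context: For $(q,z)\in\mathbb{C}^2$ with $|q|<1$, the partial theta function is $\theta(q,z):=\sum_{j=0}^{\infty}q^{j(j+1)/2}z^j$. Here $q$ is regarded as a parameter and $z$ as the variable; for each fixed $q$ with $|q|<1$ the function $\theta(q,\cdot)$ is entire in $z$. *)

theory Defs
  imports "HOL-Complex_Analysis.Complex_Analysis"
begin

text \<open>The partial theta function; the series is only meaningful for \<open>norm q < 1\<close>.\<close>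

definition partial_theta :: "complex \<Rightarrow> complex \<Rightarrow> complex" where
  "partial_theta q z = (\<Sum>j. q ^ (j * (j + 1) div 2) * z ^ j)"

text \<open>
  The finiteness conjunct is needed because \<open>sum\<close> is \<open>0\<close> on infinite sets.
  The notion is meant for functions that are holomorphic on an open set \<open>A\<close>: finiteness
  then makes every zero isolated, so that \<open>zorder f z\<close> is its (positive) multiplicity.
\<close>

definition has_zero_count_on :: "(complex \<Rightarrow> complex) \<Rightarrow> complex set \<Rightarrow> nat \<Rightarrow> bool" where
  "has_zero_count_on f A n \<longleftrightarrow>
     finite {z \<in> A. f z = 0} \<and> (\<Sum>z\<in>{z \<in> A. f z = 0}. zorder f z) = int n"

lemma partial_theta_summable:
  fixes q z :: complex
  assumes "norm q < 1"
  shows "summable (\<lambda>j. q ^ (j * (j + 1) div 2) * z ^ j)"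
proof -
  have "(\<lambda>j. norm q ^ Suc j * norm z) \<longlonglongrightarrow> 0 * norm z"
    by (rule tendsto_mult_right[OF LIMSEQ_Suc[OF LIMSEQ_power_zero]]) (simp add: assms)
  hence "eventually (\<lambda>j. norm q ^ Suc j * norm z < 1 / 2) sequentially"
    by (rule order_tendstoD) simp
  then obtain N where N: "\<And>j. j \<ge> N \<Longrightarrow> norm q ^ Suc j * norm z < 1 / 2"
    by (auto simp: eventually_sequentially)
  show ?thesis
  proof (rule summable_ratio_test[of "1/2" N])
    fix j assume j: "j \<ge> N"
    have tri: "Suc j * (Suc j + 1) div 2 = j * (j + 1) div 2 + Suc j"
    proof -
      have "Suc j * (Suc j + 1) = j * (j + 1) + 2 * Suc j"
        by (simp add: algebra_simps)
      thus ?thesis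
        using div_mult_self2[of 2 "j * (j + 1)" "Suc j"] by linarith
    qed
    have "norm (q ^ (Suc j * (Suc j + 1) div 2) * z ^ Suc j) =
            (norm q ^ Suc j * norm z) * norm (q ^ (j * (j + 1) div 2) * z ^ j)"
      unfolding tri by (simp only: norm_mult norm_power power_add power_Suc mult_ac)
    also have "\<dots> \<le> 1 / 2 * norm (q ^ (j * (j + 1) div 2) * z ^ j)"
      using N[OF j] by (intro mult_right_mono) auto
    finally show "norm (q ^ (Suc j * (Suc j + 1) div 2) * z ^ Suc j) \<le>
            1 / 2 * norm (q ^ (j * (j + 1) div 2) * z ^ j)" .
  qed simp
qed

lemma partial_theta_0 [simp]: "partial_theta q 0 = 1"
  unfolding partial_theta_def
  by (subst powser_zero[of "\<lambda>j. q ^ (j * (j + 1) div 2)"]) simp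

lemma partial_theta_holomorphic:
  assumes "norm q < 1"
  shows "partial_theta q holomorphic_on UNIV"
proof -
  define c where "c = (\<lambda>j::nat. q ^ (j * (j + 1) div 2))"
  have eq: "partial_theta q = (\<lambda>z. \<Sum>j. c j * z ^ j)"
    by (intro ext) (simp only: partial_theta_def c_def)
  have summable: "summable (\<lambda>j. c j * z ^ j)" for z
    unfolding c_def by (rule partial_theta_summable[OF assms])
  have "(partial_theta q has_field_derivative (\<Sum>j. diffs c j * z ^ j)) (at z)" for z
    unfolding eq using summable by (rule termdiffs_strong_converges_everywhere)
  thus ?thesis
    unfolding holomorphic_on_open[OF open_UNIV] by blast
qed

end

theory Submission
  imports Defs
begin

text \<open>
  Put \<open>s = sqrt (norm q)\<close>. On the circle \<open>norm z = s ^ (-2 * n - 1)\<close> the \<open>j\<close>-th term of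
  \<open>\<theta>(q, z)\<close> has modulus \<open>s ^ (-n^2) * s ^ ((j - n)^2)\<close>, so the terms with \<open>j\<close> near \<open>n\<close>
  dominate. Unless \<open>norm q\<close> is small, no single term outweighs the others; however, all
  coefficients may be changed by factors that are nearly constant for \<open>j\<close> near \<open>n\<close> and bounded
  elsewhere. Dividing the \<open>j\<close>-th coefficient by \<open>(q;q)_j = (1 - q) \<cdots> (1 - q^j)\<close> is such a
  change, because \<open>(q;q)_j\<close> converges geometrically as \<open>j\<close> grows. By a theorem of Euler it
  turns the partial theta function into a product:
  \<open>E(z) = (\<Sum>j. q ^ (j (j + 1) / 2) z ^ j / (q;q)_j) = (\<Prod>m\<ge>1. 1 + q ^ m z)\<close>.
  The zeros of \<open>E\<close> are the simple points \<open>- q ^ (-m)\<close>, and exactly \<open>n\<close> of them lie inside the circle.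

  Rouche's theorem transfers this count from \<open>(q;q)_n E\<close> to \<open>\<theta>(q, \<cdot>)\<close>. Both estimates are uniform
  for \<open>s \<le> \<sigma> = sqrt \<delta>\<close>: the difference \<open>\<theta> / (q;q)_n - E\<close> is at most a constant times
  \<open>\<sigma> ^ n * s ^ (-n^2)\<close> (\<open>partial_theta_near_euler_series\<close>), while the product formula gives
  \<open>norm (E z) \<ge> c^2 * s ^ (-n^2)\<close> with \<open>c = (\<Prod>k. 1 - \<sigma> ^ (2 k + 1)) > 0\<close>
  (\<open>euler_series_lower_bound\<close>). Since \<open>\<sigma> ^ n\<close> tends to \<open>0\<close>, the second wins for all large \<open>n\<close>.

  The product formula enters in a finite form: iterating the functional equation
  \<open>E(z) = (1 + q z) E(q z)\<close> splits off any number of factors, and the rest \<open>E(q ^ N z)\<close> is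
  controlled by continuity of \<open>E\<close> at \<open>0\<close>, where \<open>E(0) = 1\<close>.
\<close>

section \<open>Counting zeros in a disc\<close>

lemma has_zero_count_on_linear_factors:
  assumes "finite A" and "A \<subseteq> S" and "open S" and "G holomorphic_on S"
    and nz: "\<And>z. z \<in> S \<Longrightarrow> G z \<noteq> 0"
    and fac: "\<And>z. z \<in> S \<Longrightarrow> f z = (\<Prod>a\<in>A. z - a) * G z"
  shows "has_zero_count_on f S (card A)"
proof -
  have zeros: "{z \<in> S. f z = 0} = A"
    using assms by (auto simp: fac)
  have "zorder f a = 1" if a: "a \<in> A" for a
  proof (rule zorder_eqI[where S = S and g = "\<lambda>w. (\<Prod>b\<in>A - {a}. w - b) * G w"])
    fix w assume w: "w \<in> S" "w \<noteq> a"
    have "(\<Prod>b\<in>A. w - b) = (w - a) * (\<Prod>b\<in>A - {a}. w - b)"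
      by (rule prod.remove) (use assms a in auto)
    thus "f w = ((\<Prod>b\<in>A - {a}. w - b) * G w) * (w - a) powi 1"
      using fac[OF w(1)] by simp
  next
    show "(\<Prod>b\<in>A - {a}. a - b) * G a \<noteq> 0"
      using assms a by (auto simp: prod_zero_iff)
  qed (use assms a in \<open>auto intro!: holomorphic_intros\<close>)
  thus ?thesis
    using assms by (simp add: has_zero_count_on_def zeros)
qed

lemma finite_zeros_bounded:
  assumes "f holomorphic_on UNIV" and "f w \<noteq> 0" and "bounded S"
  shows "finite {z \<in> S. f z = 0}"
proof (cases "f constant_on UNIV")
  case True
  hence "f z \<noteq> 0" for z
    using assms(2) by (metis UNIV_I constant_on_def)
  thus ?thesis by simp
next
  case False
  have "finite {z \<in> closure S. f z = 0}"
    by (rule holomorphic_compact_finite_zeros[of f UNIV]) (use assms False in auto)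
  thus ?thesis
    by (rule rev_finite_subset) (use closure_subset in auto)
qed

text \<open>
  Rouche's theorem needs an open set around the closed disc on which the zeros are finite in number,
  since an entire function may have infinitely many zeros. In the slightly larger disc, the winding
  number is \<open>1\<close> at the zeros inside the circle and \<open>0\<close> at those outside.
\<close>

lemma winding_sum_circlepath:
  assumes "finite {z \<in> ball 0 (R + 1). f z = 0}"
    and "\<And>z. norm z = R \<Longrightarrow> f z \<noteq> 0" and "R > 0"
  shows "(\<Sum>p\<in>{z \<in> ball 0 (R + 1). f z = 0}. winding_number (circlepath 0 R) p * zorder f p)
       = of_int (\<Sum>p\<in>{z \<in> ball 0 R. f z = 0}. zorder f p)"
proof -
  have "(\<Sum>p\<in>{z \<in> ball 0 R. f z = 0}. winding_number (circlepath 0 R) p * zorder f p)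
      = (\<Sum>p\<in>{z \<in> ball 0 (R + 1). f z = 0}. winding_number (circlepath 0 R) p * zorder f p)"
  proof (rule sum.mono_neutral_left[OF assms(1)])
    show "\<forall>p\<in>{z \<in> ball 0 (R + 1). f z = 0} - {z \<in> ball 0 R. f z = 0}.
            winding_number (circlepath 0 R) p * zorder f p = 0"
    proof
      fix p assume p: "p \<in> {z \<in> ball 0 (R + 1). f z = 0} - {z \<in> ball 0 R. f z = 0}"
      hence "norm p > R"
        using assms(2)[of p] by force
      hence "winding_number (circlepath 0 R) p = 0"
        by (intro winding_number_zero_outside[where s = "cball 0 R"]) (use \<open>R > 0\<close> in auto)
      thus "winding_number (circlepath 0 R) p * zorder f p = 0" by simp
    qed
  qed auto
  also have "(\<Sum>p\<in>{z \<in> ball 0 R. f z = 0}. winding_number (circlepath 0 R) p * zorder f p)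
      = (\<Sum>p\<in>{z \<in> ball 0 R. f z = 0}. of_int (zorder f p))"
    by (rule sum.cong) (auto simp: winding_number_circlepath)
  finally show ?thesis by simp
qed

lemma Rouche_zero_count:
  assumes f: "f holomorphic_on UNIV" and g: "g holomorphic_on UNIV" and "R > 0"
    and less: "\<And>z. norm z = R \<Longrightarrow> norm (g z) < norm (f z)"
    and count: "has_zero_count_on f (ball 0 R) n"
  shows "has_zero_count_on (\<lambda>z. f z + g z) (ball 0 R) n"
proof -
  let ?h = "\<lambda>z. f z + g z"
  have nz_f: "f z \<noteq> 0" if "norm z = R" for z
    using less[OF that] by auto
  have nz_h: "?h z \<noteq> 0" if "norm z = R" for z
    using less[OF that] by (metis add_eq_0_iff norm_minus_cancel less_irrefl)
  have R: "norm (of_real R :: complex) = R"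
    using \<open>R > 0\<close> by simp
  have h: "?h holomorphic_on UNIV"
    by (intro holomorphic_intros f g)
  have fin_f: "finite {z \<in> ball 0 (R + 1). f z = 0}"
    by (rule finite_zeros_bounded[OF f nz_f[OF R]]) auto
  have fin_h: "finite {z \<in> ball 0 (R + 1). ?h z = 0}"
    by (rule finite_zeros_bounded[OF h nz_h[OF R]]) auto
  have "(\<Sum>p\<in>{z \<in> ball 0 (R + 1). ?h z = 0}. winding_number (circlepath 0 R) p * zorder ?h p)
      = (\<Sum>p\<in>{z \<in> ball 0 (R + 1). f z = 0}. winding_number (circlepath 0 R) p * zorder f p)"
  proof (rule Rouche_theorem)
    show "\<forall>z. z \<notin> ball 0 (R + 1) \<longrightarrow> winding_number (circlepath 0 R) z = 0"
      using \<open>R > 0\<close> by (auto intro!: winding_number_zero_outside[where s = "cball 0 R"])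
    show "\<forall>z\<in>path_image (circlepath 0 R). norm (g z) < norm (f z)"
      using \<open>R > 0\<close> less by auto
  qed (use fin_f fin_h \<open>R > 0\<close> in \<open>auto intro: holomorphic_on_subset[OF f] holomorphic_on_subset[OF g]\<close>)
  hence "(\<Sum>p\<in>{z \<in> ball 0 R. ?h z = 0}. zorder ?h p) = (\<Sum>p\<in>{z \<in> ball 0 R. f z = 0}. zorder f p)"
    using winding_sum_circlepath[where f = f, OF fin_f nz_f \<open>R > 0\<close>]
      winding_sum_circlepath[where f = ?h, OF fin_h nz_h \<open>R > 0\<close>] by (simp only: of_int_eq_iff)
  moreover have "finite {z \<in> ball 0 R. ?h z = 0}"
    using fin_h by (rule rev_finite_subset) auto
  ultimately show ?thesis
    using count by (simp add: has_zero_count_on_def)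
qed

section \<open>The q-Pochhammer symbol and the Euler series\<close>

definition q_pochhammer :: "complex \<Rightarrow> nat \<Rightarrow> complex" where
  "q_pochhammer q j = (\<Prod>k<j. 1 - q ^ Suc k)"

text \<open>
  The infinite product \<open>(\<Prod>k. 1 - \<sigma> ^ (2 k + 1))\<close> converges to a positive number, and its factors lie
  in \<open>(0, 1]\<close> and decrease in \<open>\<sigma>\<close>; so it bounds every such finite product for a smaller base from
  below. This one constant controls both \<open>(q;q)_j\<close> and the product for the Euler series.
\<close>

lemma odd_power_prod_uniform_lower_bound:
  fixes \<sigma> :: real
  assumes "0 \<le> \<sigma>" and "\<sigma> < 1"
  shows "\<exists>c>0. \<forall>s\<in>{0..\<sigma>}. \<forall>N. c \<le> (\<Prod>k<N. 1 - s ^ (2 * k + 1))"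
proof -
  define f where "f = (\<lambda>k. 1 - \<sigma> ^ (2 * k + 1))"
  have lt1: "\<sigma> ^ (2 * k + 1) < 1" for k
    using power_Suc_less_one[of \<sigma> "2*k"] assms by (cases "\<sigma> = 0") auto
  have "summable (\<lambda>k. \<sigma> * (\<sigma>^2) ^ k)"
    using assms by (intro summable_mult summable_geometric) (auto simp: power_less_one_iff abs_square_less_1)
  hence "summable (\<lambda>k. norm (f k - 1))"
    using assms by (simp add: f_def power_mult)
  hence "convergent_prod f"
    by (intro abs_convergent_prod_imp_convergent_prod summable_imp_abs_convergent_prod)
  hence hp: "f has_prod prodinf f" and pos: "prodinf f > 0"
    using lt1 by (auto intro!: less_0_prodinf simp: f_def)
  have le: "prodinf f \<le> (\<Prod>k<N. f k)" for N
    by (rule prod_ge_prodinf[OF hp]) (use lt1 assms in \<open>auto simp: f_def less_imp_le\<close>)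
  show ?thesis
  proof (intro exI conjI ballI allI)
    show "0 < prodinf f" by (rule pos)
    fix s N assume "s \<in> {0..\<sigma>}"
    hence s: "0 \<le> s" "s \<le> \<sigma>" by auto
    have "(\<Prod>k<N. f k) \<le> (\<Prod>k<N. 1 - s ^ (2 * k + 1))"
      unfolding f_def
    proof (rule prod_mono)
      fix k
      show "0 \<le> 1 - \<sigma> ^ (2 * k + 1) \<and> 1 - \<sigma> ^ (2 * k + 1) \<le> 1 - s ^ (2 * k + 1)"
        using lt1[of k] power_mono[OF s(2) s(1), of "2 * k + 1"] by linarith
    qed
    thus "prodinf f \<le> (\<Prod>k<N. 1 - s ^ (2 * k + 1))"
      using le[of N] by linarith
  qed
qed

definition euler_coeff :: "complex \<Rightarrow> nat \<Rightarrow> complex" where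
  "euler_coeff q j = q ^ (j * (j + 1) div 2) / q_pochhammer q j"

text \<open>Euler's expansion of the product of all \<open>1 + q ^ m * z\<close> with \<open>m \<ge> 1\<close>.\<close>

definition euler_series :: "complex \<Rightarrow> complex \<Rightarrow> complex" where
  "euler_series q z = (\<Sum>j. euler_coeff q j * z ^ j)"

lemma triangle_Suc: "Suc j * (Suc j + 1) div 2 = j * (j + 1) div 2 + Suc j"
  using div_mult_self2[of 2 "j * (j + 1)" "Suc j"] by simp

text \<open>
  Working with \<open>s\<close>, the square root of \<open>norm q\<close>, makes all moduli on the circle of radius
  \<open>norm q powr (- n - 1 / 2)\<close> integral powers of \<open>s\<close>. Apart from the common
  factor \<open>s ^ (-n^2)\<close>, the bounds on the critical circles are stated in terms of \<open>\<sigma>\<close> and \<open>c\<close>,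
  which can be chosen independently of \<open>q\<close>.
\<close>

context
  fixes q :: complex and s \<sigma> c :: real
  assumes s: "0 < s" "s \<le> \<sigma>" "\<sigma> < 1" and q: "norm q = s ^ 2"
    and c: "0 < c" "\<And>N. c \<le> (\<Prod>k<N. 1 - s ^ (2 * k + 1))"
begin

lemma norm_q_power: "norm (q ^ m) = s ^ (2 * m)"
  by (simp add: norm_power q power_mult)

lemma norm_q_less_1: "norm q < 1"
  using s by (simp add: q power_less_one_iff abs_square_less_1)

lemma s_power_less_1: "s ^ Suc m < 1"
  using s by (intro power_Suc_less_one) auto

text \<open>Since \<open>norm (1 - q ^ (k + 1)) \<ge> 1 - s ^ (2 k + 2) \<ge> 1 - s ^ (2 k + 1)\<close>, the odd powers suffice.\<close>

lemma q_pochhammer_norm_ge: "c \<le> norm (q_pochhammer q j)"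
proof -
  have "(\<Prod>k<j. 1 - s ^ (2 * k + 1)) \<le> (\<Prod>k<j. norm (1 - q ^ Suc k))"
  proof (rule prod_mono)
    fix k
    have "s ^ (2 * Suc k) \<le> s ^ (2 * k + 1)"
      using s by (intro power_decreasing) auto
    moreover have "1 - norm (q ^ Suc k) \<le> norm (1 - q ^ Suc k)"
      using norm_triangle_ineq2[of 1 "q ^ Suc k"] by simp
    ultimately show "0 \<le> 1 - s ^ (2 * k + 1) \<and> 1 - s ^ (2 * k + 1) \<le> norm (1 - q ^ Suc k)"
      using s_power_less_1[of "2 * k"] norm_q_power[of "Suc k"] by (simp del: power_Suc)
  qed
  thus ?thesis
    using c(2)[of j] by (simp add: q_pochhammer_def prod_norm)
qed

lemma q_pochhammer_nonzero: "q_pochhammer q j \<noteq> 0"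
  using q_pochhammer_norm_ge[of j] c(1) by auto

text \<open>
  The sequence \<open>1 / (q;q)_j\<close> has increments \<open>q ^ (i + 1) / (q;q)_(i + 1)\<close>, which are dominated by a
  geometric series.
\<close>

lemma inverse_q_pochhammer_cauchy:
  "norm (1 / q_pochhammer q (m + d) - 1 / q_pochhammer q m) \<le> \<sigma> ^ (2 * m) / (c * (1 - \<sigma>))"
proof -
  have step: "norm (1 / q_pochhammer q (Suc i) - 1 / q_pochhammer q i) \<le> s ^ (2 * Suc i) / c" for i
  proof -
    have "q_pochhammer q (Suc i) = q_pochhammer q i * (1 - q ^ Suc i)"
      by (simp add: q_pochhammer_def)
    hence "1 / q_pochhammer q (Suc i) - 1 / q_pochhammer q i = q ^ Suc i / q_pochhammer q (Suc i)"
      using q_pochhammer_nonzero[of i] q_pochhammer_nonzero[of "Suc i"]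
      by (simp add: divide_simps del: power_Suc)
    thus ?thesis
      using c(1) s q_pochhammer_norm_ge[of "Suc i"]
      by (simp only: norm_divide norm_q_power) (intro frac_le; simp)
  qed
  have "norm (1 / q_pochhammer q (m + d) - 1 / q_pochhammer q m) \<le> (\<Sum>i<d. \<sigma> ^ (2 * m) * \<sigma> ^ i / c)"
  proof (induction d)
    case (Suc d)
    have "s ^ (2 * Suc (m + d)) \<le> \<sigma> ^ (2 * Suc (m + d))"
      using s by (intro power_mono) auto
    also have "\<dots> \<le> \<sigma> ^ (2 * m + d)"
      using s by (intro power_decreasing) auto
    finally have "s ^ (2 * Suc (m + d)) / c \<le> \<sigma> ^ (2 * m) * \<sigma> ^ d / c"
      using c by (intro divide_right_mono) (auto simp: power_add)
    thus ?case
      using Suc.IH step[of "m + d"]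
        norm_triangle_ineq[of "1 / q_pochhammer q (Suc (m + d)) - 1 / q_pochhammer q (m + d)"
          "1 / q_pochhammer q (m + d) - 1 / q_pochhammer q m"]
      by simp
  qed simp
  also have "\<dots> = \<sigma> ^ (2 * m) / c * (\<Sum>i<d. \<sigma> ^ i)"
    by (simp add: sum_distrib_left sum_divide_distrib)
  also have "\<dots> \<le> \<sigma> ^ (2 * m) / c * (\<Sum>i. \<sigma> ^ i)"
    using s c(1) by (intro mult_left_mono sum_le_suminf summable_geometric) auto
  also have "(\<Sum>i. \<sigma> ^ i) = 1 / (1 - \<sigma>)"
    using s by (intro suminf_geometric) auto
  finally show ?thesis by simp
qed

lemma inverse_q_pochhammer_dist:
  "norm (1 / q_pochhammer q n - 1 / q_pochhammer q j) \<le> \<sigma> ^ (2 * min j n) / (c * (1 - \<sigma>))"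
proof (cases "j \<le> n")
  case True
  thus ?thesis
    using inverse_q_pochhammer_cauchy[of j "n - j"] by simp
next
  case False
  thus ?thesis
    using inverse_q_pochhammer_cauchy[of n "j - n"] by (subst norm_minus_commute) simp
qed

section \<open>Product expansion of the Euler series\<close>

lemma q_nonzero: "q \<noteq> 0"
  using q s by auto

lemma partial_theta_abs_summable: "summable (\<lambda>j. norm (q ^ (j * (j + 1) div 2) * z ^ j))"
  using powser_insidea[OF partial_theta_summable[OF norm_q_less_1, of "of_real (norm z + 1)"], of z]
  by (simp del: of_real_add)

lemma euler_series_summable: "summable (\<lambda>j. euler_coeff q j * z ^ j)"
proof (rule summable_comparison_test)
  show "summable (\<lambda>j. norm (q ^ (j * (j + 1) div 2) * z ^ j) / c)"
    by (intro summable_divide partial_theta_abs_summable)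
  have "norm (euler_coeff q j * z ^ j) \<le> norm (q ^ (j * (j + 1) div 2) * z ^ j) / c" for j
  proof -
    have "norm (euler_coeff q j * z ^ j)
        = norm (q ^ (j * (j + 1) div 2) * z ^ j) / norm (q_pochhammer q j)"
      by (simp add: euler_coeff_def norm_mult norm_divide)
    also have "\<dots> \<le> norm (q ^ (j * (j + 1) div 2) * z ^ j) / c"
      by (rule frac_le[OF _ order_refl c(1) q_pochhammer_norm_ge]) simp
    finally show ?thesis .
  qed
  thus "\<exists>N. \<forall>j\<ge>N. norm (euler_coeff q j * z ^ j) \<le> norm (q ^ (j * (j + 1) div 2) * z ^ j) / c"
    by blast
qed

lemma euler_series_holomorphic: "euler_series q holomorphic_on UNIV"
proof -
  have "(euler_series q has_field_derivative (\<Sum>j. diffs (euler_coeff q) j * z ^ j)) (at z)" for z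
    unfolding euler_series_def using euler_series_summable
    by (rule termdiffs_strong_converges_everywhere)
  thus ?thesis
    unfolding holomorphic_on_open[OF open_UNIV] by blast
qed

lemma euler_series_0: "euler_series q 0 = 1"
  unfolding euler_series_def by (subst powser_zero) (simp add: euler_coeff_def q_pochhammer_def)

lemma euler_coeff_Suc:
  "euler_coeff q (Suc j) * (1 - q ^ Suc j) = q * (q ^ j * euler_coeff q j)"
proof -
  have "q_pochhammer q (Suc j) = q_pochhammer q j * (1 - q ^ Suc j)"
    by (simp add: q_pochhammer_def)
  moreover from this have "1 - q ^ Suc j \<noteq> 0"
    using q_pochhammer_nonzero[of "Suc j"] by (metis mult_zero_right)
  ultimately show ?thesis
    unfolding euler_coeff_def triangle_Suc power_add by simp
qed

text \<open>
  Comparing coefficients, \<open>E(z) - E(q z) = q z E(q z)\<close> is the recursion that produces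
  \<open>q ^ (j (j + 1) / 2) / (q;q)_j\<close>.
\<close>

lemma euler_series_functional_equation:
  "euler_series q z = (1 + q * z) * euler_series q (q * z)"
proof -
  let ?e = "euler_coeff q"
  have sum_z: "summable (\<lambda>j. ?e (Suc j) * z ^ Suc j)"
    and sum_qz: "summable (\<lambda>j. ?e (Suc j) * (q * z) ^ Suc j)"
    using summable_ignore_initial_segment[OF euler_series_summable[of z], of 1]
      summable_ignore_initial_segment[OF euler_series_summable[of "q * z"], of 1]
    by (simp_all only: Suc_eq_plus1)
  have "(euler_series q z - ?e 0) - (euler_series q (q * z) - ?e 0)
      = (\<Sum>j. ?e (Suc j) * z ^ Suc j) - (\<Sum>j. ?e (Suc j) * (q * z) ^ Suc j)"
    unfolding euler_series_def
    using suminf_split_head[OF euler_series_summable[of z]]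
      suminf_split_head[OF euler_series_summable[of "q * z"]]
    by (simp only: power_0 mult_1_right)
  also have "\<dots> = (\<Sum>j. ?e (Suc j) * z ^ Suc j - ?e (Suc j) * (q * z) ^ Suc j)"
    by (rule suminf_diff[OF sum_z sum_qz])
  also have "\<dots> = (\<Sum>j. q * z * (?e j * (q * z) ^ j))"
  proof (rule suminf_cong)
    fix j
    have "?e (Suc j) * z ^ Suc j - ?e (Suc j) * (q * z) ^ Suc j
        = ?e (Suc j) * (1 - q ^ Suc j) * z ^ Suc j"
      unfolding power_mult_distrib by (simp only: algebra_simps mult_1_left)
    thus "?e (Suc j) * z ^ Suc j - ?e (Suc j) * (q * z) ^ Suc j = q * z * (?e j * (q * z) ^ j)"
      unfolding euler_coeff_Suc power_mult_distrib by (simp add: algebra_simps)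
  qed
  also have "\<dots> = q * z * euler_series q (q * z)"
    unfolding euler_series_def by (rule suminf_mult[OF euler_series_summable])
  finally show ?thesis
    by (simp add: algebra_simps)
qed

lemma euler_series_finite_product:
  "euler_series q z = (\<Prod>k<N. 1 + q ^ Suc k * z) * euler_series q (q ^ N * z)"
proof (induction N)
  case (Suc N)
  show ?case
    unfolding Suc.IH euler_series_functional_equation[of "q ^ N * z"] by (simp add: algebra_simps)
qed simp

text \<open>
  In this disc \<open>norm (q ^ (k + 1) * w) \<le> s ^ (2 k + 1)\<close>, so each partial product is at least \<open>c\<close> in
  modulus, and the remaining factor \<open>E (q ^ N * w)\<close> tends to \<open>E 0 = 1\<close>. The disc is thus free of zeros;
  it is reached from the \<open>n\<close>-th critical disc by splitting off \<open>n\<close> linear factors.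
\<close>

lemma euler_series_lower_bound_small:
  assumes "norm w \<le> 1 / s"
  shows "c \<le> norm (euler_series q w)"
proof -
  have "(\<lambda>N. q ^ N * w) \<longlonglongrightarrow> 0 * w"
    by (intro tendsto_mult_right LIMSEQ_power_zero norm_q_less_1)
  moreover have "isCont (euler_series q) 0"
    using euler_series_holomorphic holomorphic_on_imp_continuous_on
    by (metis UNIV_I continuous_on_eq_continuous_at open_UNIV)
  ultimately have "(\<lambda>N. euler_series q (q ^ N * w)) \<longlonglongrightarrow> euler_series q 0"
    using isCont_tendsto_compose[of 0 "euler_series q" "\<lambda>N. q ^ N * w" sequentially] by simp
  hence lim: "(\<lambda>N. c * norm (euler_series q (q ^ N * w))) \<longlonglongrightarrow> c * norm (1 :: complex)"
    unfolding euler_series_0 by (intro tendsto_intros)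
  have "c * norm (euler_series q (q ^ N * w)) \<le> norm (euler_series q w)" for N
  proof -
    have "(\<Prod>k<N. 1 - s ^ (2 * k + 1)) \<le> (\<Prod>k<N. norm (1 + q ^ Suc k * w))"
    proof (rule prod_mono)
      fix k
      have "norm (q ^ Suc k * w) \<le> s ^ (2 * Suc k) * (1 / s)"
        unfolding norm_mult norm_q_power using assms s by (intro mult_left_mono) auto
      also have "\<dots> = s ^ (2 * k + 1)"
        using s by simp
      finally show "0 \<le> 1 - s ^ (2 * k + 1) \<and> 1 - s ^ (2 * k + 1) \<le> norm (1 + q ^ Suc k * w)"
        using s_power_less_1[of "2 * k"] norm_triangle_ineq2[of 1 "- (q ^ Suc k * w)"]
        by (simp del: power_Suc)
    qed
    hence "c \<le> norm (\<Prod>k<N. 1 + q ^ Suc k * w)"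
      using c(2)[of N] by (simp add: prod_norm)
    thus ?thesis
      unfolding euler_series_finite_product[of w N] norm_mult
      by (intro mult_right_mono) auto
  qed
  thus ?thesis
    using LIMSEQ_le_const2[OF lim] by simp
qed

section \<open>Comparison on the critical circles\<close>

text \<open>
  The exponent \<open>j (j + 1) - (2 n + 1) j\<close> of \<open>s\<close> is \<open>(j - n)^2 - n^2\<close>. As subtraction of naturals
  truncates, \<open>(j - n) + (n - j)\<close> is the distance of \<open>j\<close> and \<open>n\<close>.
\<close>

lemma norm_theta_term:
  assumes z: "norm z = 1 / s ^ (2 * n + 1)"
  shows "norm (q ^ (j * (j + 1) div 2) * z ^ j) = s ^ (((j - n) + (n - j))^2) / s ^ (n^2)"
proof -
  have "j * (j + 1) + n^2 = ((j - n) + (n - j))^2 + (2 * n + 1) * j"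
  proof (cases "j \<le> n")
    case True
    then obtain d where "n = j + d" using le_Suc_ex by blast
    thus ?thesis by (simp add: power2_eq_square algebra_simps)
  next
    case False
    then obtain d where "j = n + d" using le_Suc_ex nat_le_linear by blast
    thus ?thesis by (simp add: power2_eq_square algebra_simps)
  qed
  hence "s ^ (j * (j + 1)) * s ^ (n^2) = s ^ (((j - n) + (n - j))^2) * s ^ ((2 * n + 1) * j)"
    by (simp only: power_add [symmetric])
  moreover have "norm (q ^ (j * (j + 1) div 2)) = s ^ (j * (j + 1))"
    unfolding norm_q_power by simp
  moreover have "norm (z ^ j) = 1 / s ^ ((2 * n + 1) * j)"
    by (simp only: norm_power z power_divide power_one power_mult)
  ultimately show ?thesis
    using s by (simp only: norm_mult) (simp add: divide_simps)
qed

text \<open>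
  The \<open>j\<close>-th term of the difference is small for two reasons: the theta term decays like
  \<open>s ^ (d^2)\<close> with \<open>d = \<bar>j - n\<bar>\<close>, and the coefficients differ by at most a multiple of
  \<open>\<sigma> ^ (2 min j n)\<close>. Together they yield \<open>\<sigma> ^ (n + j)\<close>, which is summable over \<open>j\<close> and
  leaves the factor \<open>\<sigma> ^ n\<close>.
\<close>

lemma partial_theta_near_euler_series:
  assumes z: "norm z = 1 / s ^ (2 * n + 1)"
  shows "norm (partial_theta q z / q_pochhammer q n - euler_series q z)
           \<le> \<sigma> ^ n / (c * (1 - \<sigma>)^2) / s ^ (n^2)"
proof -
  let ?t = "\<lambda>j. q ^ (j * (j + 1) div 2) * z ^ j"
  let ?u = "\<lambda>j. ?t j / q_pochhammer q n - euler_coeff q j * z ^ j"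
  let ?b = "\<lambda>j. \<sigma> ^ n / (c * (1 - \<sigma>)) / s ^ (n^2) * \<sigma> ^ j"
  have sum_t: "summable (\<lambda>j. ?t j / q_pochhammer q n)"
    by (intro summable_divide partial_theta_summable norm_q_less_1)
  have sum_b: "summable ?b"
    using s by (intro summable_mult summable_geometric) auto
  have bound: "norm (?u j) \<le> ?b j" for j
  proof -
    define d where "d = (j - n) + (n - j)"
    \<comment> \<open>Here \<open>n + j = d + 2 * min j n\<close>, and \<open>d \<le> d^2\<close> for natural \<open>d\<close>.\<close>
    have "n + j \<le> d^2 + 2 * min j n"
    proof -
      have "d \<le> d^2" by (simp add: power2_eq_square)
      thus ?thesis unfolding d_def min_def by (cases "j \<le> n") auto
    qed
    hence "\<sigma> ^ (d^2) * \<sigma> ^ (2 * min j n) \<le> \<sigma> ^ n * \<sigma> ^ j"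
      unfolding power_add [symmetric] using s by (intro power_decreasing) auto
    moreover have "s ^ (d^2) * \<sigma> ^ (2 * min j n) \<le> \<sigma> ^ (d^2) * \<sigma> ^ (2 * min j n)"
      using s by (intro mult_right_mono power_mono) auto
    ultimately have pow: "s ^ (d^2) * \<sigma> ^ (2 * min j n) \<le> \<sigma> ^ n * \<sigma> ^ j"
      by linarith
    have "?u j = ?t j * (1 / q_pochhammer q n - 1 / q_pochhammer q j)"
      by (simp add: euler_coeff_def algebra_simps)
    hence "norm (?u j) = s ^ (d^2) / s ^ (n^2) * norm (1 / q_pochhammer q n - 1 / q_pochhammer q j)"
      by (simp only: norm_mult[of "?t j"] norm_theta_term[OF z] d_def)
    also have "\<dots> \<le> s ^ (d^2) / s ^ (n^2) * (\<sigma> ^ (2 * min j n) / (c * (1 - \<sigma>)))"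
      using s by (intro mult_left_mono inverse_q_pochhammer_dist) auto
    also have "\<dots> = s ^ (d^2) * \<sigma> ^ (2 * min j n) / (c * (1 - \<sigma>) * s ^ (n^2))"
      by simp
    also have "\<dots> \<le> \<sigma> ^ n * \<sigma> ^ j / (c * (1 - \<sigma>) * s ^ (n^2))"
      using pow s c(1) by (intro divide_right_mono) auto
    finally show ?thesis by simp
  qed
  have "partial_theta q z / q_pochhammer q n - euler_series q z = (\<Sum>j. ?u j)"
    unfolding partial_theta_def euler_series_def
    using suminf_divide[OF partial_theta_summable[OF norm_q_less_1], of z "q_pochhammer q n"]
      suminf_diff[OF sum_t euler_series_summable] by simp
  also have "norm (\<Sum>j. ?u j) \<le> (\<Sum>j. ?b j)"
    using norm_suminf_le[OF bound sum_b] .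
  also have "\<dots> = \<sigma> ^ n / (c * (1 - \<sigma>)) / s ^ (n^2) * (1 / (1 - \<sigma>))"
    using s by (subst suminf_mult) (auto simp: summable_geometric suminf_geometric)
  finally show ?thesis
    by (simp add: power2_eq_square mult_ac)
qed

text \<open>
  On the circle the factors \<open>1 + q ^ m * z\<close> with \<open>m \<le> n\<close> are large, because
  \<open>norm (q ^ m * z) = s ^ (- (2 (n - m) + 1))\<close>; taking out these odd powers, with product
  \<open>s ^ (-n^2)\<close>, leaves at least \<open>c\<close>. The other factors form \<open>E (q ^ n * z)\<close>, where
  \<open>norm (q ^ n * z) = 1 / s\<close>, and contribute another \<open>c\<close>.
\<close>

lemma euler_series_lower_bound:
  assumes z: "norm z = 1 / s ^ (2 * n + 1)"
  shows "c^2 / s ^ (n^2) \<le> norm (euler_series q z)"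
proof -
  let ?g = "\<lambda>k. (1 - s ^ (2 * k + 1)) / s ^ (2 * k + 1)"
  have "norm (q ^ n * z) = 1 / s"
    unfolding norm_mult norm_q_power z using s by (simp add: power_add)
  hence "c \<le> norm (euler_series q (q ^ n * z))"
    by (intro euler_series_lower_bound_small) simp
  moreover have "c / s ^ (n^2) \<le> norm (\<Prod>k<n. 1 + q ^ Suc k * z)"
  proof -
    have "(\<Prod>k<n. s ^ (2 * k + 1)) = s ^ (n^2)"
    proof (induction n)
      case (Suc n)
      show ?case
        unfolding prod.lessThan_Suc Suc.IH power_add [symmetric]
        by (rule arg_cong[where f = "power s"]) (simp add: power2_eq_square)
    qed simp
    hence "(\<Prod>k<n. 1 - s ^ (2 * k + 1)) / s ^ (n^2) = (\<Prod>k<n. ?g k)"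
      by (simp only: prod_dividef)
    hence "c / s ^ (n^2) \<le> (\<Prod>k<n. ?g k)"
      using divide_right_mono[OF c(2)[of n], of "s ^ (n^2)"] s(1) by simp
    also have "\<dots> = (\<Prod>k<n. ?g (n - Suc k))"
      by (rule prod.nat_diff_reindex [symmetric])
    also have "\<dots> \<le> (\<Prod>k<n. norm (1 + q ^ Suc k * z))"
    proof (rule prod_mono)
      fix k assume k: "k \<in> {..<n}"
      define m where "m = 2 * (n - Suc k) + 1"
      have "2 * n + 1 = 2 * Suc k + m"
        using k by (auto simp: m_def)
      hence "norm (q ^ Suc k * z) = 1 / s ^ m"
        unfolding norm_mult norm_q_power z using s by (simp only: power_add) simp
      moreover have "?g (n - Suc k) = 1 / s ^ m - 1"
        unfolding m_def [symmetric] using s by (simp add: diff_divide_distrib)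
      moreover have "1 \<le> 1 / s ^ m"
        using s power_le_one[of s m] by simp
      ultimately show "0 \<le> ?g (n - Suc k) \<and> ?g (n - Suc k) \<le> norm (1 + q ^ Suc k * z)"
        using norm_triangle_ineq2[of "q ^ Suc k * z" "- 1"] by (simp add: add.commute)
    qed
    finally show ?thesis by (simp only: prod_norm)
  qed
  ultimately have "c / s ^ (n^2) * c
      \<le> norm (\<Prod>k<n. 1 + q ^ Suc k * z) * norm (euler_series q (q ^ n * z))"
    using c(1) by (intro mult_mono) auto
  thus ?thesis
    unfolding euler_series_finite_product[of z n] norm_mult by (simp add: power2_eq_square)
qed

text \<open>
  Splitting off the factors with \<open>m \<le> n\<close> leaves \<open>E (q ^ n * z)\<close> with \<open>norm (q ^ n * z) < 1 / s\<close>, which has no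
  zeros. So the zeros in the disc are the points \<open>- 1 / q ^ m\<close>; they are distinct because their moduli are,
  and inside because their moduli are \<open>s ^ (-2 m)\<close> with \<open>2 m < 2 n + 1\<close>.
\<close>

lemma euler_series_zero_count:
  assumes "C \<noteq> 0"
  shows "has_zero_count_on (\<lambda>z. C * euler_series q z) (ball 0 (1 / s ^ (2 * n + 1))) n"
proof -
  let ?a = "\<lambda>k. - 1 / q ^ Suc k"
  let ?S = "ball 0 (1 / s ^ (2 * n + 1)) :: complex set"
  let ?G = "\<lambda>z. C * (\<Prod>k<n. q ^ Suc k) * euler_series q (q ^ n * z)"
  have inj: "inj_on ?a {..<n}"
  proof (rule linorder_inj_onI)
    fix i j :: nat assume "i < j"
    hence "norm (q ^ Suc j) < norm (q ^ Suc i)"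
      unfolding norm_q_power using s by (intro power_strict_decreasing) auto
    thus "?a i \<noteq> ?a j" by auto
  qed auto
  have "has_zero_count_on (\<lambda>z. C * euler_series q z) ?S (card (?a ` {..<n}))"
  proof (rule has_zero_count_on_linear_factors[where G = ?G])
    show "?a ` {..<n} \<subseteq> ?S"
    proof
      fix a assume "a \<in> ?a ` {..<n}"
      then obtain k where k: "k < n" "a = ?a k" by auto
      have "s ^ (2 * n + 1) < s ^ (2 * Suc k)"
        using k s by (intro power_strict_decreasing) auto
      hence "1 / s ^ (2 * Suc k) < 1 / s ^ (2 * n + 1)"
        using s by (intro divide_strict_left_mono) auto
      moreover have "norm a = 1 / s ^ (2 * Suc k)"
        unfolding k(2) norm_divide norm_q_power by simp
      ultimately show "a \<in> ?S" by simp
    qed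
    show "?G holomorphic_on ?S"
    proof -
      have "(euler_series q \<circ> (\<lambda>z. q ^ n * z)) holomorphic_on ?S"
        by (rule holomorphic_on_compose_gen[OF _ euler_series_holomorphic])
          (auto intro!: holomorphic_intros)
      thus ?thesis by (auto intro!: holomorphic_intros simp: o_def)
    qed
    show "?G z \<noteq> 0" if "z \<in> ?S" for z
    proof -
      have "norm (q ^ n * z) \<le> s ^ (2 * n) * (1 / s ^ (2 * n + 1))"
        unfolding norm_mult norm_q_power using that s by (intro mult_left_mono) auto
      also have "\<dots> = 1 / s"
        using s by simp
      finally have "euler_series q (q ^ n * z) \<noteq> 0"
        using euler_series_lower_bound_small[of "q ^ n * z"] c(1) by auto
      thus ?thesis
        using assms q_nonzero by simp
    qed
    show "C * euler_series q z = (\<Prod>a\<in>?a ` {..<n}. z - a) * ?G z" for z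
    proof -
      have "(\<Prod>k<n. 1 + q ^ Suc k * z) = (\<Prod>k<n. (z - ?a k) * q ^ Suc k)"
        using q_nonzero by (intro prod.cong) (auto simp: field_simps)
      also have "\<dots> = (\<Prod>a\<in>?a ` {..<n}. z - a) * (\<Prod>k<n. q ^ Suc k)"
        by (simp only: prod.distrib prod.reindex[OF inj] o_def)
      finally show ?thesis
        unfolding euler_series_finite_product[of z n] by (simp only: mult_ac)
    qed
  qed auto
  thus ?thesis
    by (simp only: card_image[OF inj] card_lessThan)
qed

text \<open>
  The hypothesis makes the upper bound for \<open>\<theta> / (q;q)_n - E\<close> smaller than the lower bound for \<open>E\<close>
  on the critical circle. Multiplying by \<open>(q;q)_n\<close> lets Rouche's theorem speak about \<open>\<theta>\<close> itself.
\<close>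

lemma partial_theta_zero_count:
  assumes n: "\<sigma> ^ n / (c * (1 - \<sigma>)^2) < c^2"
  shows "has_zero_count_on (partial_theta q) (ball 0 (1 / s ^ (2 * n + 1))) n"
proof -
  let ?p = "q_pochhammer q n"
  let ?f = "\<lambda>z. ?p * euler_series q z"
  let ?g = "\<lambda>z. partial_theta q z - ?p * euler_series q z"
  have "has_zero_count_on (\<lambda>z. ?f z + ?g z) (ball 0 (1 / s ^ (2 * n + 1))) n"
  proof (rule Rouche_zero_count)
    show "norm (?g z) < norm (?f z)" if z: "norm z = 1 / s ^ (2 * n + 1)" for z
    proof -
      have "norm (partial_theta q z / ?p - euler_series q z) \<le> \<sigma> ^ n / (c * (1 - \<sigma>)^2) / s ^ (n^2)"
        by (rule partial_theta_near_euler_series[OF z])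
      also have "\<dots> < c^2 / s ^ (n^2)"
        using n s by (intro divide_strict_right_mono) auto
      also have "\<dots> \<le> norm (euler_series q z)"
        by (rule euler_series_lower_bound[OF z])
      finally have "norm ?p * norm (partial_theta q z / ?p - euler_series q z)
          < norm ?p * norm (euler_series q z)"
        using q_pochhammer_nonzero by (intro mult_strict_left_mono) auto
      moreover have "?p * (partial_theta q z / ?p - euler_series q z) = ?g z"
        using q_pochhammer_nonzero by (simp add: right_diff_distrib)
      ultimately show ?thesis
        by (metis norm_mult)
    qed
    show "has_zero_count_on ?f (ball 0 (1 / s ^ (2 * n + 1))) n"
      by (rule euler_series_zero_count[OF q_pochhammer_nonzero])
  qed (use s in \<open>auto intro!: holomorphic_intros euler_series_holomorphic
        partial_theta_holomorphic norm_q_less_1\<close>)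
  thus ?thesis by simp
qed

end

section \<open>Uniformity in the parameter\<close>

theorem theorem2:
  fixes \<delta>\<^sub>0 \<delta> :: real
  assumes "0 < \<delta>\<^sub>0" and "\<delta>\<^sub>0 < \<delta>" and "\<delta> < 1"
  shows "\<exists>n\<^sub>0 :: nat. \<forall>q :: complex. \<delta>\<^sub>0 \<le> norm q \<and> norm q \<le> \<delta> \<longrightarrow>
           (\<forall>n :: nat. n \<ge> n\<^sub>0 \<longrightarrow>
              has_zero_count_on (partial_theta q)
                {z. norm z < norm q powr (- real n - 1 / 2)} n)"
proof -
  define \<sigma> where "\<sigma> = sqrt \<delta>"
  have \<sigma>: "0 < \<sigma>" "\<sigma> < 1"
    using assms by (auto simp: \<sigma>_def)
  obtain c where c: "0 < c"
    and c_le: "\<forall>s\<in>{0..\<sigma>}. \<forall>N. c \<le> (\<Prod>k<N. 1 - s ^ (2 * k + 1))"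
    using odd_power_prod_uniform_lower_bound[OF less_imp_le[OF \<sigma>(1)] \<sigma>(2)] by blast
  have "(\<lambda>n. \<sigma> ^ n / (c * (1 - \<sigma>)^2)) \<longlonglongrightarrow> 0 / (c * (1 - \<sigma>)^2)"
    using c \<sigma> by (intro tendsto_divide LIMSEQ_power_zero tendsto_const) auto
  hence "eventually (\<lambda>n. \<sigma> ^ n / (c * (1 - \<sigma>)^2) < c^2) sequentially"
    by (rule order_tendstoD) (use c in simp)
  then obtain n0 where n0: "\<And>n. n \<ge> n0 \<Longrightarrow> \<sigma> ^ n / (c * (1 - \<sigma>)^2) < c^2"
    by (auto simp: eventually_sequentially)
  have "has_zero_count_on (partial_theta q) {z. norm z < norm q powr (- real n - 1 / 2)} n"
    if q: "\<delta>\<^sub>0 \<le> norm q" "norm q \<le> \<delta>" and n: "n \<ge> n0" for q n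
  proof -
    define s where "s = sqrt (norm q)"
    have s: "0 < s" "s \<le> \<sigma>" and qs: "norm q = s ^ 2"
      using q assms by (auto simp: s_def \<sigma>_def)
    have "norm q powr (- real n - 1 / 2) = (s powr 2) powr (- real n - 1 / 2)"
      using s by (simp add: qs powr_realpow)
    also have "\<dots> = s powr (- real (2 * n + 1))"
      unfolding powr_powr by (rule arg_cong[where f = "(powr) s"]) simp
    also have "\<dots> = 1 / s ^ (2 * n + 1)"
      unfolding powr_minus powr_realpow[OF s(1)] by (simp add: inverse_eq_divide)
    finally have "{z :: complex. norm z < norm q powr (- real n - 1 / 2)} = ball 0 (1 / s ^ (2 * n + 1))"
      by auto
    moreover have "c \<le> (\<Prod>k<N. 1 - s ^ (2 * k + 1))" for N
      using c_le s by simp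
    ultimately show ?thesis
      using partial_theta_zero_count[OF s \<sigma>(2) qs c _ n0[OF n]] by simp
  qed
  thus ?thesis by blast
qed

end
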